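(* Let $\alpha>1$ be a real number and let $m_1,m_\alpha$ be real numbers with $m_1>0$ and $m_\alpha>m_1^\alpha$. (a) Suppose $\alpha\in(2,\infty)$ and let $\overline q(m_1,\alpha)=m_1(\alpha-1)\alpha^{(2-\alpha)/(\alpha-1)}$. Then for all $q>\overline q(m_1,\alpha)$, $$\sup_{F\in\mathcal F_{1,\alpha}}\mathbb E_F[\tilde d-q]_+\;\le\;\frac{(m_\alpha-m_1^\alpha)}{\alpha^\alpha q^{\alpha-1}-\alpha^2m_1^{\alpha-1}(\alpha-1)^{\alpha-1}}(\alpha-1)^{\alpha-1}.$$ (b) Suppose $\alpha\in(1,2)$ and let $\epsilon\in\left(0,\left(\frac{\alpha}{\alpha-1}\right)^{\alpha-1}-\alpha\right)$. Then the equation $$x^\alpha-(\alpha+\epsilon)x+1-\left(x^{\alpha-1}-\alpha-\epsilon+1\right)^{\alpha/(\alpha-1)}=0$$ has a unique root $x^*$ in the interval $\left((\alpha+\epsilon)^{1/(\alpha-1)},\infty\right)$, and, with $\overline q(m_1,\alpha,\epsilon)=m_1(\alpha-1)x^*/\alpha$, for all $q>\overline q(m_1,\alpha,\epsilon)$, $$\sup_{F\in\mathcal F_{1,\alpha}}\mathbb E_F[\tilde d-q]_+\;\le\;\frac{(m_\alpha-m_1^\alpha)}{\alpha^\alpha q^{\alpha-1}-(\alpha+\epsilon)\alpha m_1^{\alpha-1}(\alpha-1)^{\alpha-1}}(\alpha-1)^{\alpha-1}.$$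
   Context: $\mathcal F_{1,\alpha}$ denotes the set of all Borel probability distributions $F$ on $[0,\infty)$ with $\int_0^\infty w\,dF(w)=m_1$ and $\int_0^\infty w^\alpha\,dF(w)=m_\alpha$. For $F\in\mathcal F_{1,\alpha}$, $\tilde d$ denotes a random variable with distribution $F$, and $\mathbb E_F[\tilde d-q]_+=\int_0^\infty \max(0,w-q)\,dF(w)$. *)

theory Defs
  imports "HOL-Probability.Probability"
begin

definition moment_class :: "real \<Rightarrow> real \<Rightarrow> real \<Rightarrow> real measure set" where
  "moment_class \<alpha> m1 m\<alpha> =
     {F. real_distribution F \<and> (AE w in F. 0 \<le> w) \<and>
         has_bochner_integral F (\<lambda>w. w) m1 \<and>
         has_bochner_integral F (\<lambda>w. w powr \<alpha>) m\<alpha>}"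

definition expected_excess :: "real measure \<Rightarrow> real \<Rightarrow> real" where
  "expected_excess F q = (\<integral>w. max 0 (w - q) \<partial>F)"

(* The supremum is taken in the extended reals, so that an upper bound for it also
   expresses boundedness (on real, Sup of an unbounded set is unspecified). *)
definition worst_case_excess :: "real \<Rightarrow> real \<Rightarrow> real \<Rightarrow> real \<Rightarrow> ereal" where
  "worst_case_excess \<alpha> m1 m\<alpha> q =
     (SUP F \<in> moment_class \<alpha> m1 m\<alpha>. ereal (expected_excess F q))"

definition qbar :: "real \<Rightarrow> real \<Rightarrow> real" where
  "qbar m1 \<alpha> = m1 * (\<alpha> - 1) * \<alpha> powr ((2 - \<alpha>) / (\<alpha> - 1))"

(* On this interval the base x powr (\<alpha> - 1) - \<alpha> - \<epsilon> + 1 exceeds 1, so powr is the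
   ordinary real power throughout. *)
definition is_threshold_root :: "real \<Rightarrow> real \<Rightarrow> real \<Rightarrow> bool" where
  "is_threshold_root \<alpha> \<epsilon> x \<longleftrightarrow>
     x \<in> {(\<alpha> + \<epsilon>) powr (1 / (\<alpha> - 1)) <..} \<and>
     x powr \<alpha> - (\<alpha> + \<epsilon>) * x + 1
       - (x powr (\<alpha> - 1) - \<alpha> - \<epsilon> + 1) powr (\<alpha> / (\<alpha> - 1)) = 0"

end

theory Submission
  imports Defs
begin

text \<open>
  Put \<open>x = \<alpha> q / (m1 (\<alpha> - 1))\<close> and \<open>s = x powr (\<alpha> - 1)\<close>, with \<open>\<kappa> = \<alpha>\<close> in the first part
  and \<open>\<kappa> = \<alpha> + \<epsilon>\<close> in the second. The stated bound is the expectation of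
  \<open>(w powr \<alpha> - m1 powr \<alpha> - \<alpha> m1 powr (\<alpha> - 1) (w - m1)) / (\<alpha> m1 powr (\<alpha> - 1) (s - \<kappa>))\<close>,
  a nonnegative function touching \<open>0\<close> at \<open>m1\<close>. Its slope is \<open>1\<close> at the \<open>z\<close> with
  \<open>(z / m1) powr (\<alpha> - 1) = s - \<kappa> + 1\<close>, and comparing there with \<open>w - q\<close> shows that it
  majorizes \<open>max 0 (w - q)\<close> as soon as
  \<open>x powr \<alpha> - \<kappa> x + 1 - (s - \<kappa> + 1) powr (\<alpha> / (\<alpha> - 1)) \<ge> 0\<close>.
  For \<open>\<kappa> = \<alpha> > 2\<close> the left-hand side vanishes at \<open>s = \<alpha>\<close> and increases in \<open>s\<close> by Young's
  inequality. For \<open>\<alpha> < 2\<close> it is, up to a positive factor, the function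
  \<open>1 - \<kappa> u + u powr p - (1 - (\<kappa> - 1) u) powr p\<close> of \<open>u = 1 / s\<close>, where
  \<open>p = \<alpha> / (\<alpha> - 1) > 2\<close>. On \<open>(0, 1 / \<kappa>)\<close> its second derivative is a positive multiple of a
  strictly increasing function, while the function itself is positive near \<open>0\<close> and vanishes with positive
  slope at \<open>1 / \<kappa>\<close>, so it has exactly one zero and is positive to the left of it.
\<close>

text \<open>Left-hand side of the threshold equation, with \<kappa> in place of
  \<open>\<alpha> + \<epsilon>\<close>.\<close>

definition gap :: "real \<Rightarrow> real \<Rightarrow> real \<Rightarrow> real" where
  "gap \<alpha> \<kappa> x = x powr \<alpha> - \<kappa> * x + 1 - (x powr (\<alpha> - 1) - \<kappa> + 1) powr (\<alpha> / (\<alpha> - 1))"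

text \<open>\<open>gap\<close> divided by \<open>x powr \<alpha>\<close>, in the variable
  \<open>u = x powr (1 - \<alpha>)\<close>; \<open>p\<close> is the exponent conjugate to
  \<alpha>.\<close>

definition rgap :: "real \<Rightarrow> real \<Rightarrow> real \<Rightarrow> real" where
  "rgap \<kappa> p u = 1 - \<kappa> * u + u powr p - (1 - (\<kappa> - 1) * u) powr p"

section \<open>Tangent majorant and the resulting moment bound\<close>

text \<open>Young's inequality with weights \<open>1 / a\<close> and \<open>1 - 1 / a\<close>,
  applied to \<open>w powr a\<close> and \<open>z powr a\<close> and multiplied by \<open>a\<close>;
  \<open>w = 0\<close> is computed directly.\<close>

lemma powr_above_tangent:
  fixes a w z :: real
  assumes "a > 1" "z > 0" "w \<ge> 0"
  shows "z powr a + a * z powr (a - 1) * (w - z) \<le> w powr a"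
proof (cases "w = 0")
  case True
  have "z powr (a - 1) * z = z powr a"
    using assms by (simp add: powr_diff)
  with True assms show ?thesis
    by (simp add: mult.assoc)
next
  case False
  have "(w powr a) powr (1 / a) * (z powr a) powr (1 - 1 / a)
      \<le> (1 / a) * w powr a + (1 - 1 / a) * z powr a"
    using assms False by (intro Youngs_inequality_0) auto
  moreover have "(w powr a) powr (1 / a) = w" "(z powr a) powr (1 - 1 / a) = z powr (a - 1)"
    using assms by (simp_all add: powr_powr right_diff_distrib)
  ultimately have "w * z powr (a - 1) \<le> (1 / a) * w powr a + (1 - 1 / a) * z powr a"
    by simp
  from mult_left_mono[OF this, of a]
  have "a * (w * z powr (a - 1)) \<le> a * ((1 / a) * w powr a + (1 - 1 / a) * z powr a)"
    using assms by simp
  also have "\<dots> = w powr a + (a - 1) * z powr a"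
    using assms by (simp add: field_simps)
  finally have "a * (w * z powr (a - 1)) \<le> w powr a + (a - 1) * z powr a" .
  moreover have "z powr a = z powr (a - 1) * z"
    using assms by (simp add: powr_diff)
  ultimately show ?thesis
    by (simp add: right_diff_distrib left_diff_distrib mult_ac)
qed

lemma excess_majorant:
  fixes \<alpha> m \<kappa> x w :: real
  assumes "\<alpha> > 1" "m > 0" "x > 0" "x powr (\<alpha> - 1) > \<kappa>" "gap \<alpha> \<kappa> x \<ge> 0" "w \<ge> 0"
  shows "max 0 (w - m * (\<alpha> - 1) * x / \<alpha>)
    \<le> (w powr \<alpha> - m powr \<alpha> - \<alpha> * m powr (\<alpha> - 1) * (w - m))
        / (\<alpha> * m powr (\<alpha> - 1) * (x powr (\<alpha> - 1) - \<kappa>))"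
proof -
  define s where "s = x powr (\<alpha> - 1)"
  define M where "M = m powr (\<alpha> - 1)"
  \<comment> \<open>\<open>m * t\<close> is the point where the majorant has slope 1.\<close>
  define t where "t = (s - \<kappa> + 1) powr (1 / (\<alpha> - 1))"
  define T where "T = (s - \<kappa> + 1) powr (\<alpha> / (\<alpha> - 1))"
  have s: "s - \<kappa> > 0"
    using assms by (simp add: s_def)
  have M: "M > 0" and t: "t > 0"
    using assms s by (auto simp: M_def t_def)
  have mM: "m powr \<alpha> = m * M"
    using assms by (simp add: M_def powr_diff)
  have xs: "x powr \<alpha> = x * s"
    using assms by (simp add: s_def powr_diff)
  have t1: "t powr (\<alpha> - 1) = s - \<kappa> + 1" and tT: "t powr \<alpha> = T"
    using assms s by (auto simp: t_def T_def powr_powr)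
  have tt: "t * (s - \<kappa> + 1) = T"
    using t by (simp flip: t1 tT add: powr_diff)
  have "(m * t) powr \<alpha> + \<alpha> * (m * t) powr (\<alpha> - 1) * (w - m * t) \<le> w powr \<alpha>"
    using assms t by (intro powr_above_tangent) auto
  then have "m * M * T + \<alpha> * M * (s - \<kappa> + 1) * w - \<alpha> * M * m * (t * (s - \<kappa> + 1)) \<le> w powr \<alpha>"
    using assms t by (simp add: powr_mult mM tT t1 M_def[symmetric] algebra_simps)
  then have upper: "m * M * T + \<alpha> * M * (s - \<kappa> + 1) * w - \<alpha> * M * m * T \<le> w powr \<alpha>"
    unfolding tt .
  \<comment> \<open>After scaling by \<open>\<alpha> * M * (s - \<kappa>)\<close>, the tangent of
    the majorant at \<open>m * t\<close> lies above the line
    \<open>w - m * (\<alpha> - 1) * x / \<alpha>\<close> by exactly this amount.\<close>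
  have "0 \<le> (\<alpha> - 1) * m * M * (x * s - \<kappa> * x + 1 - T)"
    using assms M by (intro mult_nonneg_nonneg) (auto simp: gap_def s_def[symmetric] T_def xs)
  with upper have "\<alpha> * M * (s - \<kappa>) * w - M * (s - \<kappa>) * (\<alpha> - 1) * m * x
      \<le> w powr \<alpha> - m * M - \<alpha> * M * (w - m)"
    by (simp add: algebra_simps)
  moreover have "(w - m * (\<alpha> - 1) * x / \<alpha>) * (\<alpha> * M * (s - \<kappa>))
      = \<alpha> * M * (s - \<kappa>) * w - M * (s - \<kappa>) * (\<alpha> - 1) * m * x"
    using assms by (simp add: field_simps)
  \<comment> \<open>The tangent at \<open>m\<close> settles the comparison with 0.\<close>
  moreover have "0 \<le> w powr \<alpha> - m * M - \<alpha> * M * (w - m)"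
    using powr_above_tangent[of \<alpha> m w] assms by (simp add: mM M_def)
  ultimately show ?thesis
    using s M assms unfolding s_def[symmetric] M_def[symmetric] mM
    by (simp add: pos_le_divide_eq)
qed

text \<open>Integrating the majorant cancels its linear term, because the mean is \<open>m1\<close>.
  Multiplying numerator and denominator by \<open>(\<alpha> - 1) powr (\<alpha> - 1)\<close> then
  expresses the result in \<open>q\<close>.\<close>

lemma worst_case_excess_le:
  fixes \<alpha> m1 m\<alpha> \<kappa> x q :: real
  assumes "\<alpha> > 1" "m1 > 0" "x > 0" "x powr (\<alpha> - 1) > \<kappa>" "gap \<alpha> \<kappa> x \<ge> 0"
    and q: "q = m1 * (\<alpha> - 1) * x / \<alpha>"
  shows "worst_case_excess \<alpha> m1 m\<alpha> q \<le>
    ereal ((m\<alpha> - m1 powr \<alpha>)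
      / (\<alpha> powr \<alpha> * q powr (\<alpha> - 1) - \<kappa> * \<alpha> * m1 powr (\<alpha> - 1) * (\<alpha> - 1) powr (\<alpha> - 1))
      * (\<alpha> - 1) powr (\<alpha> - 1))"
proof -
  define y where "y = \<alpha> * m1 powr (\<alpha> - 1) * (x powr (\<alpha> - 1) - \<kappa>)"
  have "\<alpha> powr \<alpha> * q powr (\<alpha> - 1)
      = \<alpha> * m1 powr (\<alpha> - 1) * (\<alpha> - 1) powr (\<alpha> - 1) * x powr (\<alpha> - 1)"
  proof -
    have "q powr (\<alpha> - 1)
        = m1 powr (\<alpha> - 1) * (\<alpha> - 1) powr (\<alpha> - 1) * x powr (\<alpha> - 1) / \<alpha> powr (\<alpha> - 1)"
      using assms by (simp add: powr_mult powr_divide)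
    moreover have "\<alpha> powr \<alpha> = \<alpha> * \<alpha> powr (\<alpha> - 1)"
      using assms by (simp add: powr_mult_base)
    ultimately show ?thesis
      using assms by simp
  qed
  then have "\<alpha> powr \<alpha> * q powr (\<alpha> - 1) - \<kappa> * \<alpha> * m1 powr (\<alpha> - 1) * (\<alpha> - 1) powr (\<alpha> - 1)
      = y * (\<alpha> - 1) powr (\<alpha> - 1)"
    by (simp add: y_def algebra_simps)
  then have bound: "(m\<alpha> - m1 powr \<alpha>)
      / (\<alpha> powr \<alpha> * q powr (\<alpha> - 1) - \<kappa> * \<alpha> * m1 powr (\<alpha> - 1) * (\<alpha> - 1) powr (\<alpha> - 1))
      * (\<alpha> - 1) powr (\<alpha> - 1) = (m\<alpha> - m1 powr \<alpha>) / y"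
    using assms by simp
  have "expected_excess F q \<le> (m\<alpha> - m1 powr \<alpha>) / y" if F: "F \<in> moment_class \<alpha> m1 m\<alpha>" for F
  proof -
    from F interpret real_distribution F
      by (simp add: moment_class_def)
    have pos: "AE w in F. 0 \<le> w"
      and first: "has_bochner_integral F (\<lambda>w. w) m1"
      and upper: "has_bochner_integral F (\<lambda>w. w powr \<alpha>) m\<alpha>"
      using F by (auto simp: moment_class_def)
    have const: "has_bochner_integral F (\<lambda>_. c) c" for c :: real
      using prob_space by (simp add: has_bochner_integral_iff)
    have major: "has_bochner_integral F
        (\<lambda>w. (w powr \<alpha> - m1 powr \<alpha> - \<alpha> * m1 powr (\<alpha> - 1) * (w - m1)) / y)
        ((m\<alpha> - m1 powr \<alpha> - \<alpha> * m1 powr (\<alpha> - 1) * (m1 - m1)) / y)"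
      by (intro has_bochner_integral_divide has_bochner_integral_diff
          has_bochner_integral_mult_right first upper const)
    have "integrable F (\<lambda>w. max 0 (w - q))"
      using has_bochner_integral_diff[OF first const]
      by (intro integrable_max) (auto simp: has_bochner_integral_iff)
    then have "expected_excess F q
        \<le> (\<integral>w. (w powr \<alpha> - m1 powr \<alpha> - \<alpha> * m1 powr (\<alpha> - 1) * (w - m1)) / y \<partial>F)"
      unfolding expected_excess_def
    proof (rule integral_mono_AE)
      show "AE w in F. max 0 (w - q)
          \<le> (w powr \<alpha> - m1 powr \<alpha> - \<alpha> * m1 powr (\<alpha> - 1) * (w - m1)) / y"
        using pos by eventually_elim (unfold q y_def, intro excess_majorant, use assms in auto)
    qed (use major in \<open>simp add: has_bochner_integral_iff\<close>)
    also have "\<dots> = (m\<alpha> - m1 powr \<alpha>) / y"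
      using has_bochner_integral_integral_eq[OF major] by simp
    finally show ?thesis .
  qed
  then show ?thesis
    unfolding bound worst_case_excess_def by (auto intro: SUP_least)
qed

section \<open>Sign of the gap for \<open>\<alpha> > 2\<close>\<close>

lemma gap_nonneg:
  fixes \<alpha> x :: real
  assumes "\<alpha> > 2" "x > 0" "x powr (\<alpha> - 1) \<ge> \<alpha>"
  shows "gap \<alpha> \<alpha> x \<ge> 0"
proof -
  define p where "p = \<alpha> / (\<alpha> - 1)"
  \<comment> \<open>\<open>gap\<close> in the variable \<open>s = x powr (\<alpha> - 1)\<close>, so
    that \<open>x = s powr (p - 1)\<close>.\<close>
  define P where "P s = s powr p - \<alpha> * s powr (p - 1) + 1 - (s - \<alpha> + 1) powr p" for s
  have p: "1 < p" "p < 2" and p1: "p - 1 = 1 / (\<alpha> - 1)" and \<alpha>p: "\<alpha> * (p - 1) = p"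
    using assms by (auto simp: p_def field_simps)
  have "P \<alpha> \<le> P (x powr (\<alpha> - 1))"
  proof (rule DERIV_nonneg_imp_nondecreasing[where f = P])
    fix s :: real
    assume s: "\<alpha> \<le> s" "s \<le> x powr (\<alpha> - 1)"
    have deriv: "(P has_real_derivative
        (p * s powr (p - 1) - \<alpha> * ((p - 1) * s powr (p - 2)) - p * (s - \<alpha> + 1) powr (p - 1))) (at s)"
      unfolding P_def using assms s by (auto intro!: derivative_eq_intros)
    \<comment> \<open>The weight \<open>2 - p\<close> is positive because
      \<open>\<alpha> > 2\<close>; by \<open>\<alpha> * (p - 1) = p\<close> the right-hand side
      reduces to \<open>s - 1\<close>.\<close>
    have "(s - \<alpha> + 1) powr (p - 1) * s powr (2 - p) \<le> (p - 1) * (s - \<alpha> + 1) + (2 - p) * s"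
      using p s assms by (intro Youngs_inequality_0) auto
    then have "(s - \<alpha> + 1) powr (p - 1) * s powr (2 - p) \<le> s - 1"
      using \<alpha>p by (simp add: algebra_simps)
    then have "(s - \<alpha> + 1) powr (p - 1) * s powr (2 - p) * s powr (p - 2) \<le> (s - 1) * s powr (p - 2)"
      by (intro mult_right_mono) auto
    moreover have "s powr (2 - p) * s powr (p - 2) = 1" "s * s powr (p - 2) = s powr (p - 1)"
      using s assms by (simp_all flip: powr_add add: powr_mult_base)
    ultimately have "(s - \<alpha> + 1) powr (p - 1) \<le> s powr (p - 1) - s powr (p - 2)"
      by (simp add: mult.assoc left_diff_distrib)
    then have "p * (s - \<alpha> + 1) powr (p - 1) \<le> p * (s powr (p - 1) - s powr (p - 2))"
      using p by simp
    moreover have "\<alpha> * ((p - 1) * s powr (p - 2)) = p * s powr (p - 2)"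
      using \<alpha>p by (simp flip: mult.assoc)
    ultimately have "0 \<le> p * s powr (p - 1) - \<alpha> * ((p - 1) * s powr (p - 2))
        - p * (s - \<alpha> + 1) powr (p - 1)"
      unfolding right_diff_distrib by linarith
    with deriv show "\<exists>D. (P has_real_derivative D) (at s) \<and> 0 \<le> D"
      by blast
  qed (use assms in auto)
  moreover have "P \<alpha> = 0"
    using assms by (simp add: P_def powr_diff)
  moreover have "P (x powr (\<alpha> - 1)) = gap \<alpha> \<alpha> x"
    using assms by (simp add: P_def gap_def p1 powr_powr) (simp add: p_def)
  ultimately show ?thesis
    by simp
qed

section \<open>Sign and zeros of the rescaled gap, for \<open>\<alpha> < 2\<close>\<close>

lemma gap_eq_rgap:
  fixes \<alpha> \<kappa> x :: real
  assumes "\<alpha> > 1" "x > 0" "x powr (\<alpha> - 1) > \<kappa>"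
  shows "gap \<alpha> \<kappa> x = x powr \<alpha> * rgap \<kappa> (\<alpha> / (\<alpha> - 1)) (x powr (1 - \<alpha>))"
proof -
  define s where "s = x powr (\<alpha> - 1)"
  have s: "s > 0" "s - \<kappa> + 1 > 0"
    using assms by (auto simp: s_def)
  have "x powr (1 - \<alpha>) = 1 / s"
    by (simp add: s_def flip: powr_minus_divide)
  moreover have "x powr \<alpha> = s powr (\<alpha> / (\<alpha> - 1))"
    using assms by (simp add: s_def powr_powr)
  moreover have "x powr \<alpha> = x * s"
    using assms by (simp add: s_def powr_diff)
  moreover have "1 - (\<kappa> - 1) * (1 / s) = (s - \<kappa> + 1) / s"
    using s by (simp add: field_simps)
  ultimately show ?thesis
    using s by (simp add: gap_def rgap_def s_def[symmetric] powr_divide)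
      (simp add: field_simps)
qed

lemma rgap_DERIV:
  fixes \<kappa> p u :: real
  assumes "\<kappa> > 1" "u > 0" "u \<le> 1 / \<kappa>"
  shows "(rgap \<kappa> p has_real_derivative
    (p * u powr (p - 1) - \<kappa> + p * (\<kappa> - 1) * (1 - (\<kappa> - 1) * u) powr (p - 1))) (at u)"
    and "((\<lambda>u. p * u powr (p - 1) - \<kappa> + p * (\<kappa> - 1) * (1 - (\<kappa> - 1) * u) powr (p - 1))
      has_real_derivative
      (p * (p - 1) * (u powr (p - 2) - (\<kappa> - 1)\<^sup>2 * (1 - (\<kappa> - 1) * u) powr (p - 2)))) (at u)"
proof -
  have "(\<kappa> - 1) * u < 1"
    using assms by (simp add: field_simps)
  then show "(rgap \<kappa> p has_real_derivative
    (p * u powr (p - 1) - \<kappa> + p * (\<kappa> - 1) * (1 - (\<kappa> - 1) * u) powr (p - 1))) (at u)"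
    and "((\<lambda>u. p * u powr (p - 1) - \<kappa> + p * (\<kappa> - 1) * (1 - (\<kappa> - 1) * u) powr (p - 1))
      has_real_derivative
      (p * (p - 1) * (u powr (p - 2) - (\<kappa> - 1)\<^sup>2 * (1 - (\<kappa> - 1) * u) powr (p - 2)))) (at u)"
    unfolding rgap_def using assms
    by (auto intro!: derivative_eq_intros simp: algebra_simps power2_eq_square)
qed

lemma rgap_end: "\<kappa> > 0 \<Longrightarrow> rgap \<kappa> p (1 / \<kappa>) = 0"
  by (simp add: rgap_def diff_divide_distrib left_diff_distrib)

text \<open>The term \<open>u powr p\<close> is nonnegative and is dropped; the rest vanishes at 0
  with slope \<open>p * (\<kappa> - 1) - \<kappa>\<close>, which is positive because
  \<open>\<kappa> > p / (p - 1)\<close>.\<close>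

lemma rgap_pos_near_0:
  fixes \<kappa> p :: real
  assumes "p > 1" "p / (p - 1) < \<kappa>"
  obtains d where "d > 0" "\<And>u. 0 < u \<Longrightarrow> u < d \<Longrightarrow> rgap \<kappa> p u > 0"
proof -
  have slope: "p * (\<kappa> - 1) - \<kappa> > 0"
    using assms by (simp add: field_simps)
  have "((\<lambda>u. 1 - \<kappa> * u - (1 - (\<kappa> - 1) * u) powr p) has_real_derivative
      (p * (\<kappa> - 1) - \<kappa>)) (at 0)"
    by (auto intro!: derivative_eq_intros simp: algebra_simps)
  from DERIV_pos_inc_right[OF this slope] obtain d where d: "d > 0"
    "\<And>u. 0 < u \<Longrightarrow> u < d \<Longrightarrow> 0 < 1 - \<kappa> * u - (1 - (\<kappa> - 1) * u) powr p"
    by auto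
  show ?thesis
  proof
    show "rgap \<kappa> p u > 0" if "0 < u" "u < d" for u
      using d(2)[OF that] powr_ge_zero[of u p] unfolding rgap_def by linarith
  qed fact
qed

text \<open>Otherwise \<open>rgap\<close> is positive at some \<open>v < u\<close>, at most 0 at
  \<open>u\<close>, and 0 at \<open>r\<close> and \<open>1 / \<kappa>\<close>. Mean values give
  slopes that are negative, then nonnegative, then 0, so the second derivative is positive and later
  at most 0, although its sign is that of the strictly increasing \<open>T\<close>. This yields
  uniqueness of the root as well.\<close>

lemma rgap_pos_below_root:
  fixes \<kappa> p r u :: real
  assumes "p > 2" "p / (p - 1) < \<kappa>"
    and r: "r < 1 / \<kappa>" "rgap \<kappa> p r = 0" and u: "0 < u" "u < r"
  shows "rgap \<kappa> p u > 0"
proof (rule ccontr)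
  assume "\<not> rgap \<kappa> p u > 0"
  then have neg: "rgap \<kappa> p u \<le> 0"
    by simp
  define D where "D u = p * u powr (p - 1) - \<kappa> + p * (\<kappa> - 1) * (1 - (\<kappa> - 1) * u) powr (p - 1)" for u
  define T where "T u = u powr (p - 2) - (\<kappa> - 1)\<^sup>2 * (1 - (\<kappa> - 1) * u) powr (p - 2)" for u
  have "1 < p / (p - 1)"
    using assms by (simp add: field_simps)
  then have \<kappa>: "\<kappa> > 1"
    using assms by linarith
  have D: "(rgap \<kappa> p has_real_derivative D x) (at x)"
    and T: "(D has_real_derivative p * (p - 1) * T x) (at x)" if "0 < x" "x \<le> 1 / \<kappa>" for x
    using rgap_DERIV[OF \<kappa> that, of p] unfolding D_def T_def by auto
  \<comment> \<open>As \<open>p > 2\<close>, the first power in \<open>T\<close> increases strictly,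
    while the subtracted one does not increase.\<close>
  have T_mono: "T a < T b" if "0 < a" "a < b" "b \<le> 1 / \<kappa>" for a b
  proof -
    have "(\<kappa> - 1) * b < 1"
      using that \<kappa> by (simp add: field_simps)
    then have "(1 - (\<kappa> - 1) * b) powr (p - 2) \<le> (1 - (\<kappa> - 1) * a) powr (p - 2)"
      using that \<kappa> assms by (intro powr_mono2) auto
    moreover have "a powr (p - 2) < b powr (p - 2)"
      using that assms by (intro powr_less_mono2) auto
    ultimately show ?thesis
      unfolding T_def by (smt (verit) mult_left_mono zero_le_power2)
  qed
  obtain d where d: "d > 0" "\<And>v. 0 < v \<Longrightarrow> v < d \<Longrightarrow> rgap \<kappa> p v > 0"
    using rgap_pos_near_0[of p \<kappa>] assms by auto
  define v where "v = min d u / 2"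
  have v: "0 < v" "v < u" "rgap \<kappa> p v > 0"
    using d u by (auto simp: v_def)
  have mvt: "\<exists>z>a. z < b \<and> rgap \<kappa> p b - rgap \<kappa> p a = (b - a) * D z"
    if "0 < a" "a < b" "b \<le> 1 / \<kappa>" for a b
    using that by (intro MVT2 D) auto
  have mvt': "\<exists>z>a. z < b \<and> D b - D a = (b - a) * (p * (p - 1) * T z)"
    if "0 < a" "a < b" "b \<le> 1 / \<kappa>" for a b
    using that by (intro MVT2 T) auto
  obtain z1 where z1: "v < z1" "z1 < u" "rgap \<kappa> p u - rgap \<kappa> p v = (u - v) * D z1"
    using mvt[of v u] u v r by auto
  obtain z2 where z2: "u < z2" "z2 < r" "rgap \<kappa> p r - rgap \<kappa> p u = (r - u) * D z2"
    using mvt[of u r] u r by auto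
  obtain z3 where z3: "r < z3" "z3 < 1 / \<kappa>" "rgap \<kappa> p (1 / \<kappa>) - rgap \<kappa> p r = (1 / \<kappa> - r) * D z3"
    using mvt[of r "1 / \<kappa>"] u r by auto
  have D1: "D z1 < 0"
    using z1 neg v by (smt (verit) mult_nonneg_nonneg)
  have D2: "D z2 \<ge> 0"
    using z2 neg r u by (smt (verit) mult_pos_neg)
  have D3: "D z3 = 0"
    using z3 r \<kappa> by (simp add: rgap_end)
  obtain y1 where y1: "z1 < y1" "y1 < z2" "D z2 - D z1 = (z2 - z1) * (p * (p - 1) * T y1)"
    using mvt'[of z1 z2] z1 z2 v r by auto
  obtain y2 where y2: "z2 < y2" "y2 < z3" "D z3 - D z2 = (z3 - z2) * (p * (p - 1) * T y2)"
    using mvt'[of z2 z3] z1 z2 z3 v by auto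
  have "0 < (z2 - z1) * (p * (p - 1)) * T y1" "(z3 - z2) * (p * (p - 1)) * T y2 \<le> 0"
    using y1 y2 D1 D2 D3 by (auto simp: mult.assoc)
  moreover have "0 < (z2 - z1) * (p * (p - 1))" "0 < (z3 - z2) * (p * (p - 1))"
    using z1 z2 z3 assms by auto
  ultimately have "T y1 > 0" "T y2 \<le> 0"
    by (metis zero_less_mult_pos, meson mult_pos_pos not_less)
  moreover have "T y1 < T y2"
    using y1 y2 z1 z2 z3 v by (intro T_mono) auto
  ultimately show False
    by simp
qed

text \<open>Intermediate values: \<open>rgap\<close> is positive near 0 and negative just left of
  its zero \<open>1 / \<kappa>\<close>, where \<open>\<kappa> powr (p - 1) < p\<close> makes the
  slope positive.\<close>

lemma rgap_root_exists:
  fixes \<kappa> p :: real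
  assumes "p > 2" "p / (p - 1) < \<kappa>" "\<kappa> powr (p - 1) < p"
  obtains r where "0 < r" "r < 1 / \<kappa>" "rgap \<kappa> p r = 0"
proof -
  have "1 < p / (p - 1)"
    using assms by (simp add: field_simps)
  then have \<kappa>: "\<kappa> > 1"
    using assms by linarith
  obtain d where d: "d > 0" "\<And>u. 0 < u \<Longrightarrow> u < d \<Longrightarrow> rgap \<kappa> p u > 0"
    using rgap_pos_near_0[of p \<kappa>] assms by auto
  define L where "L = 1 / \<kappa>"
  have L: "L > 0"
    using \<kappa> by (simp add: L_def)
  \<comment> \<open>At \<open>L\<close> both powers have the same base, so the derivative collapses
    to a single power.\<close>
  have "1 - (\<kappa> - 1) * L = L" "\<kappa> * L = 1"
    using \<kappa> by (auto simp: L_def field_simps)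
  then have "p * L powr (p - 1) - \<kappa> + p * (\<kappa> - 1) * (1 - (\<kappa> - 1) * L) powr (p - 1)
      = \<kappa> * (p * L powr (p - 1) - 1)"
    by (simp add: algebra_simps)
  moreover have "p * L powr (p - 1) > 1"
    using assms \<kappa> by (simp add: L_def powr_divide)
  ultimately have "0 < p * L powr (p - 1) - \<kappa> + p * (\<kappa> - 1) * (1 - (\<kappa> - 1) * L) powr (p - 1)"
    using \<kappa> by simp
  from DERIV_pos_inc_left[OF rgap_DERIV(1) this] \<kappa> L
  obtain e where e: "e > 0" "\<And>h. 0 < h \<Longrightarrow> h < e \<Longrightarrow> rgap \<kappa> p (L - h) < rgap \<kappa> p L"
    by (auto simp: L_def)
  \<comment> \<open>Thirds ensure \<open>a \<le> L / 3\<close> and \<open>b \<ge> 2 * L / 3\<close>,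
    hence \<open>a < b\<close>.\<close>
  define a where "a = min d L / 3"
  define b where "b = L - min e L / 3"
  have ab: "0 < a" "a < b" "b < L" "a < d"
    using d e L by (auto simp: a_def b_def)
  have "rgap \<kappa> p b < 0"
    using e(2)[of "min e L / 3"] e(1) L rgap_end[of \<kappa> p] \<kappa> by (auto simp: b_def L_def)
  moreover have "rgap \<kappa> p a > 0"
    using d ab by auto
  moreover have "isCont (rgap \<kappa> p) u" if "a \<le> u" "u \<le> b" for u
    using rgap_DERIV(1)[OF \<kappa>, of u p] that ab by (auto simp: L_def intro: DERIV_isCont)
  ultimately obtain r where r: "a \<le> r" "r \<le> b" "rgap \<kappa> p r = 0"
    using IVT2[of "rgap \<kappa> p" b 0 a] ab by auto
  show ?thesis
    by (rule that[of r]) (use r ab in \<open>auto simp: L_def\<close>)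
qed

section \<open>Transfer between \<open>x\<close> and \<open>u = x powr (1 - \<alpha>)\<close>, and
  the two bounds\<close>

lemma powr_recip_less_iff:
  fixes a \<kappa> x :: real
  assumes "x > 0" "\<kappa> > 0"
  shows "x powr (1 - a) < 1 / \<kappa> \<longleftrightarrow> \<kappa> < x powr (a - 1)"
proof -
  have "1 / s < 1 / \<kappa> \<longleftrightarrow> \<kappa> < s" if "s > 0" for s
    using that assms by (simp add: field_simps)
  from this[of "x powr (a - 1)"] show ?thesis
    using assms by (simp flip: powr_minus_divide)
qed

text \<open>The substitution carries the search interval to
  \<open>0 < u < 1 / (\<alpha> + \<epsilon>)\<close>. The clause \<open>x > 0\<close> excludes
  \<open>x = 0\<close>, where \<open>0 powr (1 - \<alpha>) = 0\<close> is a spurious zero of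
  \<open>rgap\<close>.\<close>

lemma is_threshold_root_iff:
  fixes \<alpha> \<epsilon> x :: real
  assumes "\<alpha> > 1" "\<epsilon> > 0"
  shows "is_threshold_root \<alpha> \<epsilon> x \<longleftrightarrow>
    x > 0 \<and> x powr (1 - \<alpha>) < 1 / (\<alpha> + \<epsilon>) \<and> rgap (\<alpha> + \<epsilon>) (\<alpha> / (\<alpha> - 1)) (x powr (1 - \<alpha>)) = 0"
proof (cases "x > 0")
  case True
  have "(\<alpha> + \<epsilon>) powr (1 / (\<alpha> - 1)) < x \<longleftrightarrow>
      ((\<alpha> + \<epsilon>) powr (1 / (\<alpha> - 1))) powr (\<alpha> - 1) < x powr (\<alpha> - 1)"
    using assms True by (auto intro: powr_less_mono2 dest: powr_less_cancel2[rotated -1])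
  also have "\<dots> \<longleftrightarrow> \<alpha> + \<epsilon> < x powr (\<alpha> - 1)"
    using assms by (simp add: powr_powr)
  finally have iff: "(\<alpha> + \<epsilon>) powr (1 / (\<alpha> - 1)) < x \<longleftrightarrow> \<alpha> + \<epsilon> < x powr (\<alpha> - 1)" .
  have "x powr (1 - \<alpha>) < 1 / (\<alpha> + \<epsilon>) \<longleftrightarrow> \<alpha> + \<epsilon> < x powr (\<alpha> - 1)"
    using assms True by (intro powr_recip_less_iff) auto
  moreover have "is_threshold_root \<alpha> \<epsilon> x \<longleftrightarrow> \<alpha> + \<epsilon> < x powr (\<alpha> - 1) \<and> gap \<alpha> (\<alpha> + \<epsilon>) x = 0"
    using iff by (simp add: is_threshold_root_def gap_def algebra_simps)
  ultimately show ?thesis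
    using gap_eq_rgap[OF assms(1) True, of "\<alpha> + \<epsilon>"] True by auto
next
  case False
  then have "\<not> (\<alpha> + \<epsilon>) powr (1 / (\<alpha> - 1)) < x"
    using powr_ge_zero[of "\<alpha> + \<epsilon>" "1 / (\<alpha> - 1)"] by linarith
  with False show ?thesis
    by (auto simp: is_threshold_root_def)
qed

theorem proposition3p4:
  fixes \<alpha> m1 m\<alpha> :: real
  assumes "\<alpha> > 1" and "m1 > 0" and "m\<alpha> > m1 powr \<alpha>"
  shows "(\<alpha> > 2 \<longrightarrow>
           (\<forall>q > qbar m1 \<alpha>.
              worst_case_excess \<alpha> m1 m\<alpha> q \<le>
                ereal ((m\<alpha> - m1 powr \<alpha>)
                  / (\<alpha> powr \<alpha> * q powr (\<alpha> - 1)
                      - \<alpha>\<^sup>2 * m1 powr (\<alpha> - 1) * (\<alpha> - 1) powr (\<alpha> - 1))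
                  * (\<alpha> - 1) powr (\<alpha> - 1))))
       \<and> (\<alpha> < 2 \<longrightarrow>
           (\<forall>\<epsilon> \<in> {0 <..< (\<alpha> / (\<alpha> - 1)) powr (\<alpha> - 1) - \<alpha>}.
              (\<exists>!x. is_threshold_root \<alpha> \<epsilon> x) \<and>
              (\<forall>xstar. is_threshold_root \<alpha> \<epsilon> xstar \<longrightarrow>
                 (\<forall>q > m1 * (\<alpha> - 1) * xstar / \<alpha>.
                    worst_case_excess \<alpha> m1 m\<alpha> q \<le>
                      ereal ((m\<alpha> - m1 powr \<alpha>)
                        / (\<alpha> powr \<alpha> * q powr (\<alpha> - 1)
                            - (\<alpha> + \<epsilon>) * \<alpha> * m1 powr (\<alpha> - 1) * (\<alpha> - 1) powr (\<alpha> - 1))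
                        * (\<alpha> - 1) powr (\<alpha> - 1))))))"
proof (intro conjI impI allI ballI)
  fix q
  assume \<alpha>: "\<alpha> > 2" and q: "q > qbar m1 \<alpha>"
  \<comment> \<open>This inverts \<open>q = m1 * (\<alpha> - 1) * x / \<alpha>\<close>;
    \<open>q = qbar m1 \<alpha>\<close> corresponds to
    \<open>x powr (\<alpha> - 1) = \<alpha>\<close>.\<close>
  define x where "x = \<alpha> * q / (m1 * (\<alpha> - 1))"
  have "\<alpha> powr ((2 - \<alpha>) / (\<alpha> - 1)) = \<alpha> powr (1 / (\<alpha> - 1) - 1)"
    using \<alpha> by (simp add: field_simps)
  also have "\<dots> = \<alpha> powr (1 / (\<alpha> - 1)) / \<alpha>"
    using \<alpha> by (simp add: powr_diff)
  finally have "q > m1 * (\<alpha> - 1) * (\<alpha> powr (1 / (\<alpha> - 1)) / \<alpha>)"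
    using q by (simp add: qbar_def)
  then have x: "\<alpha> powr (1 / (\<alpha> - 1)) < x"
    using \<alpha> assms by (simp add: x_def pos_less_divide_eq pos_divide_less_eq mult.commute)
  then have "(\<alpha> powr (1 / (\<alpha> - 1))) powr (\<alpha> - 1) < x powr (\<alpha> - 1)"
    using \<alpha> by (intro powr_less_mono2) auto
  then have s: "\<alpha> < x powr (\<alpha> - 1)"
    using \<alpha> by (simp add: powr_powr)
  have pos: "x > 0"
    using x powr_ge_zero[of \<alpha> "1 / (\<alpha> - 1)"] by linarith
  have "q = m1 * (\<alpha> - 1) * x / \<alpha>"
    using \<alpha> assms by (simp add: x_def)
  then show "worst_case_excess \<alpha> m1 m\<alpha> q \<le>
      ereal ((m\<alpha> - m1 powr \<alpha>)
        / (\<alpha> powr \<alpha> * q powr (\<alpha> - 1)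
            - \<alpha>\<^sup>2 * m1 powr (\<alpha> - 1) * (\<alpha> - 1) powr (\<alpha> - 1))
        * (\<alpha> - 1) powr (\<alpha> - 1))"
    unfolding power2_eq_square
    using \<alpha> assms s pos gap_nonneg by (intro worst_case_excess_le[where x = x]) auto
next
  fix \<epsilon>
  assume \<alpha>: "\<alpha> < 2" and \<epsilon>: "\<epsilon> \<in> {0 <..< (\<alpha> / (\<alpha> - 1)) powr (\<alpha> - 1) - \<alpha>}"
  define p where "p = \<alpha> / (\<alpha> - 1)"
  define \<kappa> where "\<kappa> = \<alpha> + \<epsilon>"
  have p: "p > 2" and p1: "p - 1 = 1 / (\<alpha> - 1)" and "p / (p - 1) = \<alpha>"
    using \<alpha> assms by (auto simp: p_def field_simps)
  then have \<kappa>: "p / (p - 1) < \<kappa>"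
    using \<epsilon> by (simp add: \<kappa>_def)
  have root_iff: "is_threshold_root \<alpha> \<epsilon> x \<longleftrightarrow>
      x > 0 \<and> x powr (1 - \<alpha>) < 1 / \<kappa> \<and> rgap \<kappa> p (x powr (1 - \<alpha>)) = 0" for x
    unfolding \<kappa>_def p_def using assms \<epsilon> by (intro is_threshold_root_iff) auto
  have antimono: "b powr (1 - \<alpha>) < a powr (1 - \<alpha>)" if "0 < a" "a < b" for a b
    using that assms by (intro powr_less_mono2_neg) auto
  \<comment> \<open>The exponent \<open>1 - \<alpha>\<close> is negative: right of a root in
    \<open>x\<close> means left of it in \<open>u\<close>.\<close>
  have right_pos: "0 < rgap \<kappa> p (x powr (1 - \<alpha>))"
    if "is_threshold_root \<alpha> \<epsilon> y" "y < x" for x y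
    using that p \<kappa> antimono[of y x]
    by (intro rgap_pos_below_root[where r = "y powr (1 - \<alpha>)"]) (auto simp: root_iff)
  show "\<exists>!x. is_threshold_root \<alpha> \<epsilon> x"
  proof (rule ex_ex1I)
    \<comment> \<open>The upper bound on \<epsilon> says
      \<open>\<kappa> < p powr (\<alpha> - 1)\<close>; raised to the power
      \<open>p - 1 = 1 / (\<alpha> - 1)\<close> it gives the slope condition at
      \<open>1 / \<kappa>\<close>.\<close>
    have "\<kappa> powr (p - 1) < (p powr (\<alpha> - 1)) powr (p - 1)"
      using \<epsilon> assms p by (intro powr_less_mono2) (auto simp: \<kappa>_def p_def)
    also have "\<dots> = p"
      using assms p by (simp add: powr_powr p1)
    finally obtain r where r: "0 < r" "r < 1 / \<kappa>" "rgap \<kappa> p r = 0"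
      using rgap_root_exists p \<kappa> by blast
    have "(r powr (1 / (1 - \<alpha>))) powr (1 - \<alpha>) = r"
      using r assms by (simp add: powr_powr)
    with r show "\<exists>x. is_threshold_root \<alpha> \<epsilon> x"
      by (intro exI[of _ "r powr (1 / (1 - \<alpha>))"]) (simp add: root_iff)
    \<comment> \<open>If two roots differed, \<open>rgap\<close> would be positive at the larger
      one.\<close>
    show "x = y" if "is_threshold_root \<alpha> \<epsilon> x" "is_threshold_root \<alpha> \<epsilon> y" for x y
      using that right_pos[of x y] right_pos[of y x] by (force simp: root_iff)
  qed
  fix xstar q
  assume root: "is_threshold_root \<alpha> \<epsilon> xstar" and q: "q > m1 * (\<alpha> - 1) * xstar / \<alpha>"
  define x where "x = \<alpha> * q / (m1 * (\<alpha> - 1))"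
  have x: "xstar < x"
    using q assms by (simp add: x_def field_simps)
  have pos: "x > 0"
    using x root by (simp add: root_iff)
  have "x powr (1 - \<alpha>) < 1 / \<kappa>"
    using antimono[of xstar x] x root by (auto simp: root_iff)
  then have s: "\<kappa> < x powr (\<alpha> - 1)"
    using pos assms \<epsilon> by (simp add: powr_recip_less_iff \<kappa>_def)
  have "0 \<le> gap \<alpha> \<kappa> x"
    using gap_eq_rgap[OF assms(1) pos s] right_pos[OF root x] by (simp add: p_def)
  moreover have "q = m1 * (\<alpha> - 1) * x / \<alpha>"
    using assms by (simp add: x_def)
  ultimately show "worst_case_excess \<alpha> m1 m\<alpha> q \<le>
      ereal ((m\<alpha> - m1 powr \<alpha>)
        / (\<alpha> powr \<alpha> * q powr (\<alpha> - 1)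
            - (\<alpha> + \<epsilon>) * \<alpha> * m1 powr (\<alpha> - 1) * (\<alpha> - 1) powr (\<alpha> - 1))
        * (\<alpha> - 1) powr (\<alpha> - 1))"
    unfolding \<kappa>_def[symmetric]
    using assms s pos by (intro worst_case_excess_le[where x = x]) auto
qed

end
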